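(* Let $G$ be an edge-colored graph of order $n\geq 3$. If for each vertex $v$ of $G$, $d^c(v)>\frac{3n}{4}$, then each vertex of $G$ is contained in a rainbow $C_4$.
   Context: All graphs are finite, simple and undirected. An edge-colored graph is a graph $G$ together with an arbitrary mapping $c:E(G)\to\mathbb{N}$ (not required to be a proper coloring). The order of $G$ is $|V(G)|$. The color-degree $d^c(v)$ of a vertex $v$ is the number of distinct colors on the edges incident to $v$. A subgraph of $G$ is rainbow if its edges have pairwise distinct colors. $C_4$ denotes the cycle of length four (a not necessarily induced subgraph of $G$). *)

theory Defs
  imports Complex_Main
begin

text \<open>
  A graph is given by its vertex set and its set of edges, an edge being the two-element set of
  its endpoints. An edge-coloring is a function on all sets of vertices, but only its values on
  the edges are ever used.
\<close>

definition simple_graph :: "'a set \<Rightarrow> 'a set set \<Rightarrow> bool" where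
  "simple_graph V E \<longleftrightarrow> finite V \<and> (\<forall>e\<in>E. e \<subseteq> V \<and> card e = 2)"

definition subgraph :: "'a set \<Rightarrow> 'a set set \<Rightarrow> 'a set \<Rightarrow> 'a set set \<Rightarrow> bool" where
  "subgraph W F V E \<longleftrightarrow> simple_graph W F \<and> W \<subseteq> V \<and> F \<subseteq> E"

definition color_degree :: "'a set set \<Rightarrow> ('a set \<Rightarrow> nat) \<Rightarrow> 'a \<Rightarrow> nat" where
  "color_degree E c v = card (c ` {e \<in> E. v \<in> e})"

definition rainbow :: "('a set \<Rightarrow> nat) \<Rightarrow> 'a set set \<Rightarrow> bool" where
  "rainbow c F \<longleftrightarrow> inj_on c F"

definition is_C4 :: "'a set \<Rightarrow> 'a set set \<Rightarrow> bool" where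
  "is_C4 W F \<longleftrightarrow> (\<exists>a b x y. distinct [a, b, x, y] \<and> W = {a, b, x, y} \<and>
     F = {{a, b}, {b, x}, {x, y}, {y, a}})"

end

theory Submission
  imports Defs
begin

text \<open>
  Suppose that \<open>v\<close> lies on no rainbow four-cycle. Put \<open>D = \<lfloor>3n/4\<rfloor> + 1\<close>, a lower bound for all
  color-degrees, and let \<open>X\<close> be a set of \<open>D\<close> neighbors of \<open>v\<close> joined to \<open>v\<close> by edges of pairwise
  distinct colors.

  A vertex \<open>w \<noteq> v\<close> also has \<open>D\<close> neighbors in distinct colors, at least \<open>2D - n\<close> of which lie in
  \<open>X\<close>. Call a neighbor \<open>x \<in> X\<close> of \<open>w\<close> repeated for \<open>w\<close> if \<open>wx\<close> and \<open>vx\<close> have the same color. If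
  \<open>x\<close> and \<open>y\<close> are two of those \<open>2D - n\<close> vertices, both not repeated, the only coincidences that can
  keep the cycle \<open>v x w y\<close> from being rainbow are between opposite edges, that is, \<open>wx\<close> has the
  color of \<open>vy\<close> or \<open>wy\<close> has the color of \<open>vx\<close>. Every \<open>x\<close> accounts for at most one pair \<open>{x, y}\<close>
  through the color of \<open>wx\<close>, so \<open>k\<close> such vertices give \<open>k(k - 1)/2 \<le> k\<close>, hence \<open>k \<le> 3\<close>
  (\<open>card_le_3_if_pairs_matched\<close>). So at least \<open>2D - n - 3\<close> vertices are repeated for \<open>w\<close>
  (\<open>card_repeated_ge\<close>).

  On the other hand, \<open>x\<close> has at most \<open>n - 1\<close> edges and at least \<open>D\<close> colors, so the color of \<open>vx\<close>
  occurs on at most \<open>n - 1 - D\<close> further edges at \<open>x\<close> (\<open>card_same_color_le\<close>). Counting the pairs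
  \<open>(w, x)\<close> with \<open>x\<close> repeated for \<open>w\<close> in both ways yields
  \<open>(n - 1)(2D - n - 3) \<le> D(n - 1 - D)\<close>, and with \<open>4D \<ge> 3n + 1\<close> this becomes
  \<open>(5n - 9)(n - 5) \<le> 0\<close>, so \<open>n \<le> 5\<close>. As \<open>D \<le> n - 1\<close> forces \<open>n \<ge> 5\<close>, only \<open>n = 5\<close> is left. There the
  graph is a properly colored complete graph, for which the conditions on opposite edges of the
  four-cycles through \<open>v\<close> contradict each other (\<open>proper_K5\<close>).
\<close>

definition on_rainbow_C4 :: "'a set \<Rightarrow> 'a set set \<Rightarrow> ('a set \<Rightarrow> nat) \<Rightarrow> 'a \<Rightarrow> bool" where
  "on_rainbow_C4 V E c v \<longleftrightarrow>
    (\<exists>W F. subgraph W F V E \<and> is_C4 W F \<and> rainbow c F \<and> v \<in> W)"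

definition neighbors :: "'a set set \<Rightarrow> 'a \<Rightarrow> 'a set" where
  "neighbors E v = {x. {v, x} \<in> E}"

lemma neighbors_sym: "x \<in> neighbors E v \<longleftrightarrow> v \<in> neighbors E x"
  by (simp add: neighbors_def insert_commute)

lemma neighbors_subset:
  assumes "simple_graph V E"
  shows "neighbors E v \<subseteq> V - {v}"
proof
  fix x assume "x \<in> neighbors E v"
  hence "{v, x} \<subseteq> V" "card {v, x} = 2"
    using assms by (auto simp: neighbors_def simple_graph_def)
  thus "x \<in> V - {v}" by (cases "x = v") auto
qed

lemma finite_neighbors:
  assumes "simple_graph V E"
  shows "finite (neighbors E v)"
  using neighbors_subset[OF assms] assms
  by (meson finite_Diff finite_subset simple_graph_def)

lemma color_degree_neighbors:
  assumes "simple_graph V E"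
  shows "color_degree E c v = card ((\<lambda>x. c {v, x}) ` neighbors E v)"
proof -
  have "{e \<in> E. v \<in> e} = (\<lambda>x. {v, x}) ` neighbors E v"
  proof (intro set_eqI iffI)
    fix e assume e: "e \<in> {e \<in> E. v \<in> e}"
    hence "card e = 2" using assms by (auto simp: simple_graph_def)
    then obtain x y where "e = {x, y}" by (auto simp: card_2_iff)
    with e have "e = {v, x} \<or> e = {v, y}" by auto
    thus "e \<in> (\<lambda>x. {v, x}) ` neighbors E v" using e by (auto simp: neighbors_def)
  qed (auto simp: neighbors_def)
  thus ?thesis by (simp add: color_degree_def image_image)
qed

lemma rainbow_star_exists:
  assumes "simple_graph V E" and "D \<le> color_degree E c v"
  obtains X where "X \<subseteq> neighbors E v" "card X = D" "inj_on (\<lambda>x. c {v, x}) X"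
proof -
  obtain C where C: "C \<subseteq> (\<lambda>x. c {v, x}) ` neighbors E v" "card C = D"
    using assms(2) unfolding color_degree_neighbors[OF assms(1)]
    by (metis obtain_subset_with_card_n)
  then obtain X where "X \<subseteq> neighbors E v" "inj_on (\<lambda>x. c {v, x}) X" "C = (\<lambda>x. c {v, x}) ` X"
    by (meson subset_image_inj)
  with C that show thesis by (simp add: card_image)
qed

lemma on_rainbow_C4_I:
  assumes "simple_graph V E" and "distinct [v, x, w, y]"
    and "{v, x} \<in> E" "{w, x} \<in> E" "{w, y} \<in> E" "{v, y} \<in> E"
    and "distinct [c {v, x}, c {w, x}, c {w, y}, c {v, y}]"
  shows "on_rainbow_C4 V E c v"
proof -
  let ?W = "{v, x, w, y}" and ?F = "{{v, x}, {x, w}, {w, y}, {y, v}}"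
  have F: "?F \<subseteq> E" using assms(3-6) by (simp add: insert_commute)
  have "?W \<subseteq> V" using assms(1,3,5) by (auto simp: simple_graph_def)
  moreover have "simple_graph ?W ?F" using assms(2) by (auto simp: simple_graph_def)
  ultimately have "subgraph ?W ?F V E" using F by (simp add: subgraph_def)
  moreover have "is_C4 ?W ?F" using assms(2) unfolding is_C4_def by blast
  moreover have "rainbow c ?F"
    using assms(7) by (auto simp: rainbow_def inj_on_def insert_commute)
  ultimately show ?thesis unfolding on_rainbow_C4_def by blast
qed

text \<open>
  The graph of the partial map sending \<open>x\<close> to the \<open>y\<close> with \<open>f x = g y\<close> has at most \<open>card S\<close> elements,
  and together with its converse it covers all \<open>card S * (card S - 1)\<close> off-diagonal pairs.
\<close>
lemma card_le_3_if_pairs_matched: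
  assumes "finite S" and "inj_on g S"
    and "\<And>x y. x \<in> S \<Longrightarrow> y \<in> S \<Longrightarrow> x \<noteq> y \<Longrightarrow> f x = g y \<or> f y = g x"
  shows "card S \<le> 3"
proof -
  define A where "A = {(x, y) \<in> S \<times> S. f x = g y}"
  have fin: "finite A" unfolding A_def by (rule finite_subset[of _ "S \<times> S"]) (use assms in auto)
  have "inj_on fst A" using assms(2) by (auto simp: A_def inj_on_def)
  hence "card A \<le> card S" by (rule card_inj_on_le) (use assms in \<open>auto simp: A_def\<close>)
  moreover have "card (S \<times> S) \<le> card ((A \<union> A\<inverse>) \<union> (\<lambda>x. (x, x)) ` S)"
    by (rule card_mono) (use assms fin in \<open>auto simp: A_def\<close>)
  moreover have "card ((A \<union> A\<inverse>) \<union> (\<lambda>x. (x, x)) ` S) \<le> card A + card (A\<inverse>) + card S"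
    using card_Un_le[of "A \<union> A\<inverse>" "(\<lambda>x. (x, x)) ` S"] card_Un_le[of A "A\<inverse>"]
      card_image_le[OF assms(1), of "\<lambda>x. (x, x)"] by linarith
  ultimately have "card S * card S \<le> 3 * card S"
    unfolding card_cartesian_product card_inverse by linarith
  thus ?thesis by (cases "card S = 0") auto
qed

lemma card_repeated_ge:
  assumes G: "simple_graph V E" and no: "\<not> on_rainbow_C4 V E c v" and "w \<noteq> v"
    and X: "X \<subseteq> neighbors E v" "card X = D" "inj_on (\<lambda>x. c {v, x}) X"
    and deg: "D \<le> color_degree E c w"
  shows "2 * D \<le> card V + 3 + card {x \<in> X. {w, x} \<in> E \<and> c {w, x} = c {v, x}}"
    (is "_ \<le> _ + card ?R")
proof -
  obtain Y where Y: "Y \<subseteq> neighbors E w" "card Y = D" "inj_on (\<lambda>x. c {w, x}) Y"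
    using rainbow_star_exists[OF G deg] .
  have finXY: "finite X" "finite Y"
    using X Y finite_neighbors[OF G] by (auto intro: finite_subset)
  define S where "S = {x \<in> X \<inter> Y. c {w, x} \<noteq> c {v, x}}"
  have "card S \<le> 3"
  proof (rule card_le_3_if_pairs_matched)
    show "finite S" using finXY by (simp add: S_def)
    show "inj_on (\<lambda>x. c {v, x}) S" using X(3) by (rule inj_on_subset) (auto simp: S_def)
    fix x y assume xy: "x \<in> S" "y \<in> S" "x \<noteq> y"
    have edges: "{v, x} \<in> E" "{w, x} \<in> E" "{w, y} \<in> E" "{v, y} \<in> E"
      using xy X(1) Y(1) by (auto simp: S_def neighbors_def)
    have "v \<noteq> x" "w \<noteq> x" "w \<noteq> y" "v \<noteq> y"
      using edges neighbors_subset[OF G] by (auto simp: neighbors_def)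
    hence "distinct [v, x, w, y]" using xy \<open>w \<noteq> v\<close> by auto
    hence "\<not> distinct [c {v, x}, c {w, x}, c {w, y}, c {v, y}]"
      using on_rainbow_C4_I[OF G _ edges] no by blast
    moreover have "c {v, x} \<noteq> c {v, y}" "c {w, x} \<noteq> c {w, y}"
      using xy X(3) Y(3) by (auto simp: S_def inj_on_def)
    moreover have "c {v, x} \<noteq> c {w, x}" "c {v, y} \<noteq> c {w, y}"
      using xy by (auto simp: S_def)
    ultimately show "c {w, x} = c {v, y} \<or> c {w, y} = c {v, x}" by auto
  qed
  moreover have "card (X \<inter> Y) \<le> card (S \<union> ?R)"
    by (rule card_mono) (use finXY Y(1) in \<open>auto simp: S_def neighbors_def\<close>)
  moreover have "card (S \<union> ?R) \<le> card S + card ?R" by (rule card_Un_le)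
  moreover have "card (X \<union> Y) \<le> card V"
    using X(1) Y(1) neighbors_subset[OF G] G
    by (intro card_mono) (auto simp: simple_graph_def)
  moreover have "card X + card Y = card (X \<union> Y) + card (X \<inter> Y)"
    using finXY by (rule card_Un_Int)
  ultimately show ?thesis using X(2) Y(2) by linarith
qed

text \<open>
  Deleting all edges at \<open>x\<close> of the color of \<open>vx\<close> other than \<open>vx\<close> itself loses no color at \<open>x\<close>.
\<close>
lemma card_same_color_le:
  assumes G: "simple_graph V E" and "v \<in> neighbors E x"
    and "D \<le> color_degree E c x"
  shows "card {w \<in> V - {v}. {w, x} \<in> E \<and> c {w, x} = c {v, x}} + D + 1 \<le> card V"
    (is "card ?T + _ + _ \<le> _")
proof -
  let ?N = "neighbors E x" and ?h = "\<lambda>w. c {x, w}"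
  have fin: "finite ?N" "finite V" using finite_neighbors[OF G] G by (auto simp: simple_graph_def)
  have T: "?T \<subseteq> ?N" by (auto simp: neighbors_def insert_commute)
  have "?h ` ?N = ?h ` (?N - ?T)"
  proof
    show "?h ` ?N \<subseteq> ?h ` (?N - ?T)"
    proof
      fix k assume "k \<in> ?h ` ?N"
      then obtain w where w: "w \<in> ?N" "k = ?h w" by auto
      show "k \<in> ?h ` (?N - ?T)"
      proof (cases "w \<in> ?T")
        case True
        hence "k = ?h v" using w by (simp add: insert_commute)
        thus ?thesis using assms(2) by auto
      qed (use w in auto)
    qed
  qed auto
  hence "D \<le> card (?h ` (?N - ?T))"
    using assms(3) color_degree_neighbors[OF G] by metis
  also have "\<dots> \<le> card (?N - ?T)" using fin by (intro card_image_le) auto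
  also have "\<dots> = card ?N - card ?T" using T fin by (meson card_Diff_subset finite_subset)
  finally have "D \<le> card ?N - card ?T" .
  moreover have "card ?T \<le> card ?N" using T fin by (intro card_mono)
  moreover have "card ?N \<le> card (V - {x})"
    using neighbors_subset[OF G] fin by (intro card_mono) auto
  moreover have "x \<in> V"
    using assms(2) neighbors_sym[of x E v] neighbors_subset[OF G, of v] by auto
  hence "card (V - {x}) + 1 = card V"
    using fin by (metis Suc_eq_plus1 card_Suc_Diff1)
  ultimately show ?thesis by linarith
qed

lemma order_le_5_if_not_on_rainbow_C4:
  assumes G: "simple_graph V E" and "v \<in> V" and no: "\<not> on_rainbow_C4 V E c v"
    and deg: "\<And>w. w \<in> V \<Longrightarrow> D \<le> color_degree E c w"
    and D: "3 * card V + 1 \<le> 4 * D"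
  shows "card V \<le> 5"
proof -
  let ?P = "\<lambda>w x. {w, x} \<in> E \<and> c {w, x} = c {v, x}"
  define n where "n = card V"
  obtain X where X: "X \<subseteq> neighbors E v" "card X = D" "inj_on (\<lambda>x. c {v, x}) X"
    using rainbow_star_exists[OF G deg[OF \<open>v \<in> V\<close>]] .
  have fin: "finite V" "finite X"
    using G X(1) finite_neighbors[OF G] by (auto simp: simple_graph_def intro: finite_subset)
  have cV: "card (V - {v}) = n - 1" "1 \<le> n"
    using fin \<open>v \<in> V\<close> by (auto simp: n_def Suc_le_eq card_gt_0_iff)
  have count: "(\<Sum>w\<in>V - {v}. int (card {x \<in> X. ?P w x})) = (\<Sum>x\<in>X. int (card {w \<in> V - {v}. ?P w x}))"
    using sum_multicount_gen[of "V - {v}" X ?P "\<lambda>x. card {w \<in> V - {v}. ?P w x}"] fin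
    by (simp flip: of_nat_sum)
  have "(int n - 1) * (2 * int D - int n - 3) = (\<Sum>w\<in>V - {v}. 2 * int D - int n - 3)"
    using cV by (simp add: of_nat_diff)
  also have "\<dots> \<le> (\<Sum>w\<in>V - {v}. int (card {x \<in> X. ?P w x}))"
  proof (rule sum_mono)
    fix w assume "w \<in> V - {v}"
    thus "2 * int D - int n - 3 \<le> int (card {x \<in> X. ?P w x})"
      using card_repeated_ge[OF G no _ X deg, of w] by (auto simp: n_def)
  qed
  also have "\<dots> = (\<Sum>x\<in>X. int (card {w \<in> V - {v}. ?P w x}))" by (fact count)
  also have "\<dots> \<le> (\<Sum>x\<in>X. int n - 1 - int D)"
  proof (rule sum_mono)
    fix x assume "x \<in> X"
    hence "v \<in> neighbors E x" "x \<in> V"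
      using X(1) neighbors_sym[of x E v] neighbors_subset[OF G, of v] by auto
    thus "int (card {w \<in> V - {v}. ?P w x}) \<le> int n - 1 - int D"
      using card_same_color_le[OF G _ deg, of v x] by (auto simp: n_def)
  qed
  also have "\<dots> = int D * (int n - 1 - int D)" using X(2) by simp
  finally have main: "int D * int D + int D * (int n - 1) \<le> (int n - 1) * (int n + 3)"
    by (simp add: algebra_simps)
  \<comment> \<open>The left-hand side increases with \<open>D\<close>, so the lower bound \<open>(3n + 1)/4\<close> may replace \<open>D\<close>.\<close>
  have D': "3 * int n + 1 \<le> 4 * int D" using D by (simp add: n_def)
  have "(3 * int n + 1) * (3 * int n + 1) \<le> (4 * int D) * (4 * int D)"
    using D' by (intro mult_mono) auto
  moreover have "(3 * int n + 1) * (int n - 1) \<le> (4 * int D) * (int n - 1)"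
    using D' cV by (intro mult_right_mono) auto
  ultimately have "(5 * int n - 9) * (int n - 5) \<le> 0"
    using main by (simp add: algebra_simps)
  hence "\<not> (0 < 5 * int n - 9 \<and> 0 < int n - 5)" using mult_pos_pos leD by blast
  thus ?thesis unfolding n_def by linarith
qed

text \<open>
  At each \<open>w \<noteq> v\<close> the conditions on opposite edges force the colors of the edges from \<open>w\<close> to the
  three remaining vertices to be a cyclic shift of the colors of these vertices towards \<open>v\<close>. If
  \<open>pq\<close> has the color of \<open>vr\<close>, then the shift at \<open>p\<close> gives \<open>pr\<close> the color of \<open>vs\<close>, and the shift at
  \<open>q\<close> gives \<open>qr\<close> that color too, so the coloring is not proper at \<open>r\<close>. If \<open>pq\<close> has the color of
  \<open>vs\<close>, the roles of \<open>r\<close> and \<open>s\<close> are exchanged.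
\<close>
lemma proper_K5:
  assumes G: "simple_graph V E" and "v \<in> V" and "card V = 5"
    and deg: "\<And>w. w \<in> V \<Longrightarrow> 4 \<le> color_degree E c w"
  shows "on_rainbow_C4 V E c v"
proof (rule ccontr)
  assume no: "\<not> on_rainbow_C4 V E c v"
  have fin: "finite V" using G by (simp add: simple_graph_def)
  have star: "neighbors E w = V - {w} \<and> inj_on (\<lambda>x. c {w, x}) (V - {w})" if w: "w \<in> V" for w
  proof -
    let ?N = "neighbors E w" and ?h = "\<lambda>x. c {w, x}"
    have card4: "card (V - {w}) = 4" using w fin \<open>card V = 5\<close> by simp
    have "4 \<le> card (?h ` ?N)" using deg[OF w] color_degree_neighbors[OF G] by metis
    moreover have le: "card (?h ` ?N) \<le> card ?N"
      using finite_neighbors[OF G] by (rule card_image_le)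
    moreover have "card ?N \<le> 4"
      using card_mono[OF _ neighbors_subset[OF G], of w] fin card4 by simp
    ultimately have "card ?N = 4" "card (?h ` ?N) = card ?N" by linarith+
    moreover from this have "?N = V - {w}"
      using card_subset_eq[OF _ neighbors_subset[OF G], of w] fin card4 by simp
    ultimately show ?thesis using finite_neighbors[OF G] by (metis eq_card_imp_inj_on)
  qed
  have edge: "{x, y} \<in> E" if "x \<in> V" "y \<in> V" "x \<noteq> y" for x y
    using star[OF \<open>x \<in> V\<close>] that by (auto simp: neighbors_def)
  have proper: "c {w, x} \<noteq> c {w, y}" if "w \<in> V" "x \<in> V" "y \<in> V" "distinct [w, x, y]" for w x y
    using star[OF \<open>w \<in> V\<close>] that by (auto simp: inj_on_def)
  have opp: "c {w, x} = c {v, y} \<or> c {w, y} = c {v, x}"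
    if V: "w \<in> V" "x \<in> V" "y \<in> V" and dist: "distinct [v, w, x, y]" for w x y
  proof -
    have "\<not> distinct [c {v, x}, c {w, x}, c {w, y}, c {v, y}]"
      using on_rainbow_C4_I[OF G, of v x w y c] edge V dist \<open>v \<in> V\<close> no by auto
    moreover have "c {v, x} \<noteq> c {v, y}" "c {w, x} \<noteq> c {w, y}"
      using proper[of v x y] proper[of w x y] V dist \<open>v \<in> V\<close> by auto
    moreover have "c {v, x} \<noteq> c {w, x}" "c {v, y} \<noteq> c {w, y}"
      using proper[of x v w] proper[of y v w] V dist \<open>v \<in> V\<close> by (auto simp: insert_commute)
    ultimately show ?thesis by auto
  qed
  have "card (V - {v}) = 4" using fin \<open>v \<in> V\<close> \<open>card V = 5\<close> by simp
  then obtain p q r s where V: "V - {v} = {p, q, r, s}" and d: "distinct [p, q, r, s]"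
    by (auto simp: card_Suc_eq numeral_eq_Suc)
  have mem: "p \<in> V" "q \<in> V" "r \<in> V" "s \<in> V" and dv: "distinct [v, p, q, r, s]"
    using V d by auto
  have "c {v, p} \<noteq> c {v, q}" "c {v, p} \<noteq> c {v, r}" "c {v, p} \<noteq> c {v, s}"
    "c {v, q} \<noteq> c {v, r}" "c {v, q} \<noteq> c {v, s}" "c {v, r} \<noteq> c {v, s}"
    using proper mem dv \<open>v \<in> V\<close> by auto
  moreover have "c {p, q} = c {v, r} \<or> c {p, r} = c {v, q}"
    "c {p, q} = c {v, s} \<or> c {p, s} = c {v, q}" "c {p, r} = c {v, s} \<or> c {p, s} = c {v, r}"
    using opp[of p] mem dv by auto
  moreover have "c {p, q} = c {v, r} \<or> c {q, r} = c {v, p}"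
    "c {p, q} = c {v, s} \<or> c {q, s} = c {v, p}" "c {q, r} = c {v, s} \<or> c {q, s} = c {v, r}"
    using opp[of q p r] opp[of q p s] opp[of q r s] mem dv by (auto simp: insert_commute)
  moreover have "c {p, r} = c {v, q} \<or> c {q, r} = c {v, p}"
    "c {p, r} = c {v, s} \<or> c {r, s} = c {v, p}" "c {q, r} = c {v, s} \<or> c {r, s} = c {v, q}"
    using opp[of r p q] opp[of r p s] opp[of r q s] mem dv by (auto simp: insert_commute)
  moreover have "c {p, s} = c {v, q} \<or> c {q, s} = c {v, p}"
    "c {p, s} = c {v, r} \<or> c {r, s} = c {v, p}" "c {q, s} = c {v, r} \<or> c {r, s} = c {v, q}"
    using opp[of s p q] opp[of s p r] opp[of s q r] mem dv by (auto simp: insert_commute)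
  ultimately show False by (smt (verit))
qed

theorem theorem1p6:
  fixes V :: "'a set" and E :: "'a set set" and c :: "'a set \<Rightarrow> nat" and n :: nat
  assumes "simple_graph V E"
    and "card V = n"
    and "n \<ge> 3"
    and "\<And>v. v \<in> V \<Longrightarrow> real (color_degree E c v) > 3 * real n / 4"
  shows "\<forall>v\<in>V. \<exists>W F. subgraph W F V E \<and> is_C4 W F \<and> rainbow c F \<and> v \<in> W"
proof
  fix v assume v: "v \<in> V"
  define D where "D = 3 * n div 4 + 1"
  have deg: "D \<le> color_degree E c w" if "w \<in> V" for w
    using assms(4)[OF that] unfolding D_def by linarith
  have D: "3 * card V + 1 \<le> 4 * D" using assms(2) by (simp add: D_def)
  have "on_rainbow_C4 V E c v"
  proof (cases "card V \<le> 5")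
    case True
    have "D \<le> card (neighbors E v)"
      using deg[OF v] card_image_le[OF finite_neighbors[OF assms(1)]]
      unfolding color_degree_neighbors[OF assms(1)] by (rule order_trans)
    also have "\<dots> \<le> card (V - {v})"
      using neighbors_subset[OF assms(1)] assms(1) by (intro card_mono) (auto simp: simple_graph_def)
    also have "\<dots> = n - 1" using v assms(1,2) by (simp add: simple_graph_def)
    finally have "n = 5" "D = 4" using True D assms(2,3) by linarith+
    thus ?thesis using proper_K5[OF assms(1) v] assms(2) deg by simp
  next
    case False
    thus ?thesis using order_le_5_if_not_on_rainbow_C4[OF assms(1) v _ deg D] by blast
  qed
  thus "\<exists>W F. subgraph W F V E \<and> is_C4 W F \<and> rainbow c F \<and> v \<in> W"
    by (simp add: on_rainbow_C4_def)
qed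

end
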